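(* Let $\mathcal{A}$ be a pca that is not extensional. Then the relations $\sim_\alpha$ for $\alpha\leq\omega$ are all different, even when restricted to $\mathcal{A}$.
   Context: A pca is a set $\mathcal{A}$ with partial application $ab$ (associating to the left) containing $K,S$ with $Kab$ defined and equal to $a$, and $Sab$ defined with $Sabc\simeq ac(bc)$. Closed terms are built from elements by application; $s\simeq t$ means both undefined or both defined and equal. Relations $\sim_\alpha$ on closed terms: $s\sim_0 t$ iff $s\simeq t$; $s \sim_{\alpha+1} t$ iff $sx \sim_\alpha tx$ for all $x\in\mathcal{A}$; for limit $\alpha$, $s\sim_\alpha t$ iff $s\sim_\beta t$ for some $\beta<\alpha$. $\mathcal{A}$ is extensional if for all $f,g\in\mathcal{A}$, $f=g$ whenever $fx\simeq gx$ for every $x\in\mathcal{A}$. *)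

theory Defs
  imports Main "HOL-Library.Extended_Nat"
begin

text \<open>
  The carrier of the pca is the type \<^typ>\<open>'a\<close>; partial application is a function
  \<^typ>\<open>'a \<Rightarrow> 'a \<Rightarrow> 'a option\<close>, with \<^term>\<open>None\<close> meaning undefined.
\<close>

datatype 'a cterm = Elem 'a | App "'a cterm" "'a cterm" (infixl "\<cdot>" 70)

text \<open>Application is strict: a term is defined only if all its subterms are.\<close>

fun denote :: "('a \<Rightarrow> 'a \<Rightarrow> 'a option) \<Rightarrow> 'a cterm \<Rightarrow> 'a option" where
  "denote app (Elem a) = Some a"
| "denote app (s \<cdot> t) =
     (case denote app s of None \<Rightarrow> None
      | Some a \<Rightarrow> (case denote app t of None \<Rightarrow> None | Some b \<Rightarrow> app a b))"

definition kleene_eq :: "('a \<Rightarrow> 'a \<Rightarrow> 'a option) \<Rightarrow> 'a cterm \<Rightarrow> 'a cterm \<Rightarrow> bool" where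
  "kleene_eq app s t \<longleftrightarrow> denote app s = denote app t"

definition pca :: "('a \<Rightarrow> 'a \<Rightarrow> 'a option) \<Rightarrow> bool" where
  "pca app \<longleftrightarrow>
     (\<exists>K S. (\<forall>a b. denote app (Elem K \<cdot> Elem a \<cdot> Elem b) = Some a) \<and>
            (\<forall>a b. denote app (Elem S \<cdot> Elem a \<cdot> Elem b) \<noteq> None) \<and>
            (\<forall>a b c. kleene_eq app (Elem S \<cdot> Elem a \<cdot> Elem b \<cdot> Elem c)
                                   (Elem a \<cdot> Elem c \<cdot> (Elem b \<cdot> Elem c))))"

definition extensional_pca :: "('a \<Rightarrow> 'a \<Rightarrow> 'a option) \<Rightarrow> bool" where
  "extensional_pca app \<longleftrightarrow>
     (\<forall>f g. (\<forall>x. kleene_eq app (Elem f \<cdot> Elem x) (Elem g \<cdot> Elem x)) \<longrightarrow> f = g)"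

text \<open>
  Ordinals are represented as elements of an arbitrary well-ordered type.
  \<open>is_succ \<alpha> \<beta>\<close> says that \<open>\<alpha>\<close> is the immediate successor of \<open>\<beta>\<close>.
\<close>

definition is_succ :: "'o::wellorder \<Rightarrow> 'o \<Rightarrow> bool" where
  "is_succ \<alpha> \<beta> \<longleftrightarrow> \<beta> < \<alpha> \<and> (\<forall>\<gamma><\<alpha>. \<gamma> \<le> \<beta>)"

text \<open>The three branches are the least element, successors, and limits.\<close>

function sim ::
  "('a \<Rightarrow> 'a \<Rightarrow> 'a option) \<Rightarrow> 'o::wellorder \<Rightarrow> 'a cterm \<Rightarrow> 'a cterm \<Rightarrow> bool" where
  "sim app \<alpha> s t =
     (if \<forall>\<beta>. \<alpha> \<le> \<beta> then kleene_eq app s t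
      else if \<exists>\<beta>. is_succ \<alpha> \<beta>
        then \<forall>\<beta>\<in>{\<beta>. is_succ \<alpha> \<beta>}. \<forall>x. sim app \<beta> (s \<cdot> Elem x) (t \<cdot> Elem x)
      else \<exists>\<beta>\<in>{..<\<alpha>}. sim app \<beta> s t)"
  by pat_completeness auto
termination
  by (relation "inv_image {(\<alpha>, \<beta>). \<alpha> < \<beta>} (\<lambda>(app, \<alpha>, s, t). \<alpha>)")
     (auto simp: wf_inv_image wf is_succ_def)

declare sim.simps [simp del]

text \<open>The ordinals \<open>\<alpha> \<le> \<omega>\<close> are exactly the elements of \<^typ>\<open>enat\<close>, with \<open>\<omega> = \<infinity>\<close>.\<close>

lemma is_succ_enat: "is_succ (enat (Suc n)) \<beta> \<longleftrightarrow> \<beta> = enat n"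
  by (cases \<beta>) (auto simp: is_succ_def less_enat_def not_less le_less_Suc_eq split: enat.splits
      dest: spec[of _ "enat n"])

lemma not_is_succ_infinity: "\<not> is_succ (\<infinity>::enat) \<beta>"
proof
  assume *: "is_succ \<infinity> \<beta>"
  then obtain n where "\<beta> = enat n"
    by (auto simp: is_succ_def)
  with * show False
    by (auto simp: is_succ_def dest!: spec[of _ "enat (Suc n)"])
qed

lemma sim_0: "sim app (0::enat) s t \<longleftrightarrow> kleene_eq app s t"
  by (subst sim.simps) simp

lemma sim_Suc:
  "sim app (enat (Suc n)) s t \<longleftrightarrow> (\<forall>x. sim app (enat n) (s \<cdot> Elem x) (t \<cdot> Elem x))"
proof -
  have "\<not> enat (Suc n) \<le> enat n"
    by simp
  then have "\<not> (\<forall>\<beta>. enat (Suc n) \<le> \<beta>)" "\<exists>\<beta>. is_succ (enat (Suc n)) \<beta>"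
    using is_succ_enat by blast+
  then show ?thesis
    by (subst sim.simps) (simp add: is_succ_enat del: not_all)
qed

lemma sim_infinity: "sim app (\<infinity>::enat) s t \<longleftrightarrow> (\<exists>n. sim app (enat n) s t)"
proof -
  have "\<not> (\<infinity>::enat) \<le> enat 0"
    by simp
  then have "\<not> (\<forall>\<beta>. (\<infinity>::enat) \<le> \<beta>)"
    by blast
  then show ?thesis
    by (subst sim.simps) (auto simp: not_is_succ_infinity intro: bexI elim: less_infinityE)
qed

end

theory Submission
  imports Defs
begin

text \<open>
  If \<open>f\<close> and \<open>g\<close> witness that the pca is not extensional, then \<open>K\<^sup>n f\<close> and \<open>K\<^sup>n g\<close> are related
  at level \<open>n + 1\<close> but not at level \<open>n\<close>, because \<open>K a x = a\<close> makes \<open>K a \<sim>\<^sub>n\<^sub>+\<^sub>1 K b\<close> equivalent to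
  \<open>a \<sim>\<^sub>n b\<close>. As the relations increase with the level, all of them are different.
\<close>

text \<open>Finite levels see a term only through its denotation, since application is computed from
  the denotations of its parts. This allows \<open>Elem (c a) \<cdot> Elem x\<close> to be replaced
  by \<open>Elem a\<close>.\<close>

lemma sim_cong:
  assumes "denote app s = denote app s'" "denote app t = denote app t'"
  shows "sim app (enat n) s t \<longleftrightarrow> sim app (enat n) s' t'"
  using assms
proof (induction n arbitrary: s s' t t')
  case 0
  then show ?case
    by (simp add: sim_0[unfolded zero_enat_def] kleene_eq_def)
next
  case (Suc n)
  have "sim app (enat n) (s \<cdot> Elem x) (t \<cdot> Elem x) \<longleftrightarrow>
      sim app (enat n) (s' \<cdot> Elem x) (t' \<cdot> Elem x)" for x
    by (rule Suc.IH) (simp_all add: Suc.prems)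
  then show ?case
    by (simp add: sim_Suc)
qed

lemma sim_SucI: "sim app (enat n) s t \<Longrightarrow> sim app (enat (Suc n)) s t"
proof (induction n arbitrary: s t)
  case 0
  then show ?case
    by (simp add: sim_Suc sim_0[unfolded zero_enat_def] kleene_eq_def)
next
  case (Suc n)
  then show ?case
    using sim_Suc by blast
qed

lemma sim_mono:
  assumes "\<alpha> \<le> (\<beta>::enat)" "sim app \<alpha> s t"
  shows "sim app \<beta> s t"
proof (cases \<alpha>)
  case m: (enat m)
  have *: "sim app (enat k) s t" if "m \<le> k" for k
    using that by (induction rule: dec_induct) (use assms(2) m in \<open>auto intro: sim_SucI\<close>)
  show ?thesis
    using * assms(1) m by (cases \<beta>) (auto simp: sim_infinity)
next
  case infinity
  then show ?thesis
    using assms by simp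
qed

lemma pca_const:
  assumes "pca app"
  obtains c where "\<And>a x. app (c a) x = Some a"
proof -
  obtain K where K: "\<And>a b. denote app (Elem K \<cdot> Elem a \<cdot> Elem b) = Some a"
    using assms unfolding pca_def by blast
  \<comment> \<open>By strictness \<open>app K a\<close> is defined, so \<open>the\<close> returns
    its actual value.\<close>
  have "app (the (app K a)) b = Some a" for a b
    using K[of a b] by (simp split: option.splits)
  then show thesis
    by (rule that)
qed

lemma sim_Suc_const:
  assumes "\<And>a x. app (c a) x = Some a"
  shows "sim app (enat (Suc n)) (Elem (c a)) (Elem (c b)) \<longleftrightarrow> sim app (enat n) (Elem a) (Elem b)"
proof -
  have "sim app (enat n) (Elem (c a) \<cdot> Elem x) (Elem (c b) \<cdot> Elem x) \<longleftrightarrow>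
      sim app (enat n) (Elem a) (Elem b)" for x
    by (rule sim_cong) (simp_all add: assms)
  \<comment> \<open>The condition no longer depends on \<open>x\<close>, and the carrier is
    nonempty, so the quantifier disappears.\<close>
  then show ?thesis
    by (simp add: sim_Suc)
qed

lemma sim_Suc_strict:
  assumes "pca app" "\<not> extensional_pca app"
  shows "\<exists>a b. sim app (enat (Suc n)) (Elem a) (Elem b) \<and> \<not> sim app (enat n) (Elem a) (Elem b)"
proof (induction n)
  case 0
  \<comment> \<open>Level 0 is equality on elements, so a failure of extensionality is exactly a
    pair separating levels 0 and 1.\<close>
  then show ?case
    using assms(2)
    by (auto simp: extensional_pca_def sim_Suc sim_0[unfolded zero_enat_def] kleene_eq_def)
next
  case (Suc n)
  obtain c where "\<And>a x. app (c a) x = Some a"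
    using pca_const[OF assms(1)] by blast
  then show ?case
    using Suc.IH by (metis sim_Suc_const)
qed

text \<open>The smaller level is finite even if \<beta> is \<infinity>, so a pair separating it from
  its successor stays related up to \<beta>.\<close>

lemma sim_strict_mono:
  assumes "pca app" "\<not> extensional_pca app" "\<alpha> < (\<beta>::enat)"
  shows "\<exists>a b. sim app \<beta> (Elem a) (Elem b) \<and> \<not> sim app \<alpha> (Elem a) (Elem b)"
proof -
  obtain m where m: "\<alpha> = enat m"
    using assms(3) by (cases \<alpha>) auto
  then have "enat (Suc m) \<le> \<beta>"
    using assms(3) by (simp add: Suc_ile_eq)
  with m show ?thesis
    using sim_Suc_strict[OF assms(1,2)] sim_mono by blast
qed

theorem theorem3p4:
  fixes app :: "'a \<Rightarrow> 'a \<Rightarrow> 'a option"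
  assumes "pca app"
    and "\<not> extensional_pca app"
  shows "\<forall>\<alpha> \<beta>. (\<alpha>::enat) \<noteq> \<beta> \<longrightarrow>
      {(s, t). sim app \<alpha> s t} \<noteq> {(s, t). sim app \<beta> s t} \<and>
      {(a, b). sim app \<alpha> (Elem a) (Elem b)} \<noteq> {(a, b). sim app \<beta> (Elem a) (Elem b)}"
proof (intro allI impI)
  fix \<alpha> \<beta> :: enat
  assume "\<alpha> \<noteq> \<beta>"
  then have "\<exists>a b. sim app \<alpha> (Elem a) (Elem b) \<noteq> sim app \<beta> (Elem a) (Elem b)"
    using sim_strict_mono[OF assms] by (metis linorder_neqE)
  \<comment> \<open>Through \<open>Elem\<close>, a separating pair of elements also separates the
    relations on terms.\<close>
  then show "{(s, t). sim app \<alpha> s t} \<noteq> {(s, t). sim app \<beta> s t} \<and>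
      {(a, b). sim app \<alpha> (Elem a) (Elem b)} \<noteq> {(a, b). sim app \<beta> (Elem a) (Elem b)}"
    by (auto simp: set_eq_iff)
qed

end
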